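(* Let $\mathcal H$ be a separable Hilbert space, let $C$ and $J$ be conjugations on $\mathcal H$, and let $T$ be a bounded linear operator on $\mathcal H$ with $T=CJ|T|$. If $C|T|=|T|^{*}C$ and $CJ=JC$, then $T$ is $J$-symmetric.
   Context: A conjugation on $\mathcal H$ is an antilinear operator $C:\mathcal H\rightarrow\mathcal H$ such that $C^{2}=I$ and $\langle Cf,Cg\rangle=\langle g,f\rangle$ for all $f,g\in\mathcal H$. For a conjugation $J$, a bounded linear operator $A$ on $\mathcal H$ is $J$-symmetric if $JA=A^{*}J$. Here $|T|=\sqrt{T^{*}T}$ is the positive square root of $T^{*}T$. *)

theory Defs
  imports "HOL-Analysis.Analysis"
begin

text \<open>Complex inner products are linear in the first argument and conjugate-linear in the
  second. The real scalar multiplication, the metric and the topology of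
  \<^class>\<open>real_normed_vector\<close> are tied to the complex structure by the last two axioms.\<close>

class complex_inner = real_normed_vector +
  fixes scaleC :: "complex \<Rightarrow> 'a \<Rightarrow> 'a" (infixr "*\<^sub>C" 75)
    and cinner :: "'a \<Rightarrow> 'a \<Rightarrow> complex"
  assumes scaleC_add_right: "a *\<^sub>C (x + y) = a *\<^sub>C x + a *\<^sub>C y"
    and scaleC_add_left: "(a + b) *\<^sub>C x = a *\<^sub>C x + b *\<^sub>C x"
    and scaleC_scaleC: "a *\<^sub>C b *\<^sub>C x = (a * b) *\<^sub>C x"
    and cinner_add_left: "cinner (x + y) z = cinner x z + cinner y z"
    and cinner_scaleC_left: "cinner (a *\<^sub>C x) y = a * cinner x y"
    and cinner_commute: "cinner x y = cnj (cinner y x)"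
    and cinner_ge_zero: "cinner x x \<in> \<real>\<^sub>\<ge>\<^sub>0"
    and cinner_eq_zero_iff: "cinner x x = 0 \<longleftrightarrow> x = 0"
    and scaleR_scaleC: "r *\<^sub>R x = complex_of_real r *\<^sub>C x"
    and norm_eq_sqrt_cinner: "norm x = sqrt (Re (cinner x x))"

class complex_hilbert_space = complex_inner + complete_space

definition bounded_clinear :: "('a::complex_inner \<Rightarrow> 'a) \<Rightarrow> bool" where
  "bounded_clinear A \<longleftrightarrow> bounded_linear A \<and> (\<forall>a x. A (a *\<^sub>C x) = a *\<^sub>C A x)"

definition antilinear :: "('a::complex_inner \<Rightarrow> 'a) \<Rightarrow> bool" where
  "antilinear A \<longleftrightarrow> (\<forall>x y. A (x + y) = A x + A y) \<and> (\<forall>a x. A (a *\<^sub>C x) = cnj a *\<^sub>C A x)"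

definition conjugation :: "('a::complex_inner \<Rightarrow> 'a) \<Rightarrow> bool" where
  "conjugation C \<longleftrightarrow> antilinear C \<and> C \<circ> C = id \<and> (\<forall>f g. cinner (C f) (C g) = cinner g f)"

text \<open>For a bounded linear operator on a Hilbert space, the Riesz representation theorem gives
  existence and uniqueness of the operator described here; other arguments are irrelevant.\<close>

definition cadjoint :: "('a::complex_hilbert_space \<Rightarrow> 'a) \<Rightarrow> 'a \<Rightarrow> 'a" where
  "cadjoint A = (THE B. \<forall>x y. cinner (A x) y = cinner x (B y))"

definition positive_op :: "('a::complex_inner \<Rightarrow> 'a) \<Rightarrow> bool" where
  "positive_op A \<longleftrightarrow> bounded_clinear A \<and> (\<forall>x. cinner (A x) x \<in> \<real>\<^sub>\<ge>\<^sub>0)"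

text \<open>Every positive operator on a Hilbert space has exactly one positive square root.\<close>

definition sqrt_op :: "('a::complex_hilbert_space \<Rightarrow> 'a) \<Rightarrow> 'a \<Rightarrow> 'a" where
  "sqrt_op A = (THE B. positive_op B \<and> B \<circ> B = A)"

definition abs_op :: "('a::complex_hilbert_space \<Rightarrow> 'a) \<Rightarrow> 'a \<Rightarrow> 'a" where
  "abs_op T = sqrt_op (cadjoint T \<circ> T)"

definition J_symmetric :: "('a::complex_hilbert_space \<Rightarrow> 'a) \<Rightarrow> ('a \<Rightarrow> 'a) \<Rightarrow> bool" where
  "J_symmetric J A \<longleftrightarrow> J \<circ> A = cadjoint A \<circ> J"

end

theory Submission
  imports Defs
begin

text \<open>Write \<open>P = |T|\<close> and \<open>U = C J\<close>. As \<open>C\<close> and \<open>J\<close> are commuting isometric involutions, \<open>U\<close> is a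
  linear isometric involution, so \<open>T = U P\<close> gives \<open>P = U T\<close> and, by moving \<open>C\<close> and \<open>J\<close> across the
  inner product, \<open>T\<^sup>* = P\<^sup>* J C\<close>. Hence \<open>T\<^sup>* J = P\<^sup>* C\<close> and \<open>J T = J C J P = C P\<close>,
  and these two agree by the hypothesis \<open>C P = P\<^sup>* C\<close>.

  The analytic input is that the bounded operator \<open>P = U T\<close> really has an adjoint, so that
  \<open>cadjoint P\<close> can be moved through the inner product. This is the Riesz representation theorem,
  obtained below by minimising a quadratic functional (\<open>Riesz_representation_Re\<close>).\<close>

lemma cinner_add_right: "cinner x (y + z) = cinner x y + cinner (x::'a::complex_inner) z"
  by (metis cinner_add_left cinner_commute complex_cnj_add)

lemma Re_cinner_commute: "Re (cinner x y) = Re (cinner y (x::'a::complex_inner))"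
  by (subst cinner_commute) simp

text \<open>Multiplication by \<open>\<i>\<close> reduces complex-linear statements to statements about real parts.\<close>

lemma Im_cinner_eq_Re: "Im (cinner x y) = - Re (cinner (\<i> *\<^sub>C x) (y::'a::complex_inner))"
  by (simp add: cinner_scaleC_left)

lemma cinner_right_eqI:
  assumes "\<And>x. cinner x y = cinner x z"
  shows "y = (z::'a::complex_inner)"
proof -
  have "cinner (y - z) (y - z) + cinner (y - z) z = cinner (y - z) z"
    using assms[of "y - z"] by (simp flip: cinner_add_right)
  then show ?thesis by (simp add: cinner_eq_zero_iff)
qed

lemma norm_square_eq_Re_cinner: "(norm x)\<^sup>2 = Re (cinner x (x::'a::complex_inner))"
  using cinner_ge_zero[of x]
  by (auto simp: norm_eq_sqrt_cinner complex_nonneg_Reals_iff)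

lemma norm_add_square:
  "(norm (x + y))\<^sup>2 = (norm x)\<^sup>2 + 2 * Re (cinner x y) + (norm (y::'a::complex_inner))\<^sup>2"
  using Re_cinner_commute[of x y]
  by (simp add: norm_square_eq_Re_cinner cinner_add_left cinner_add_right)

lemma Re_cinner_scaleR_left: "Re (cinner (t *\<^sub>R x) y) = t * Re (cinner x (y::'a::complex_inner))"
  by (simp add: scaleR_scaleC cinner_scaleC_left)

lemma parallelogram_law:
  "(norm (x - y))\<^sup>2 + (norm (x + y))\<^sup>2 = 2 * (norm x)\<^sup>2 + 2 * (norm (y::'a::complex_inner))\<^sup>2"
  using norm_add_square[of "- y" x] norm_add_square[of y x] Re_cinner_scaleR_left[of "-1" y x]
  by (simp add: add.commute)

text \<open>Expanding the square in the triangle inequality for \<open>x + y\<close> leaves exactly this bound.\<close>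

lemma Re_cinner_le_norm: "Re (cinner x y) \<le> norm x * norm (y::'a::complex_inner)"
proof -
  have "(norm (x + y))\<^sup>2 \<le> (norm x + norm y)\<^sup>2"
    by (simp add: norm_triangle_ineq power_mono)
  then show ?thesis by (simp add: norm_add_square power2_sum)
qed

lemma bounded_linear_Re_cinner:
  assumes "bounded_linear A"
  shows "bounded_linear (\<lambda>x. Re (cinner (A x) (y::'a::complex_inner)))"
proof -
  interpret A: bounded_linear A by fact
  obtain K where K: "\<And>x. norm (A x) \<le> norm x * K" using A.bounded by blast
  show ?thesis
  proof (rule bounded_linear_intro[where K = "K * norm y"])
    fix x
    have "\<bar>Re (cinner (A x) y)\<bar> \<le> norm (A x) * norm y"
      using Re_cinner_le_norm[of "A x" y] Re_cinner_le_norm[of "- A x" y]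
        Re_cinner_scaleR_left[of "-1" "A x" y]
      by simp
    also have "\<dots> \<le> norm x * K * norm y" by (intro mult_right_mono K) auto
    finally show "norm (Re (cinner (A x) y)) \<le> norm x * (K * norm y)" by (simp add: mult.assoc)
  qed (simp_all add: A.add A.scaleR cinner_add_left Re_cinner_scaleR_left)
qed

text \<open>The representing vector of \<open>g\<close> is the minimiser of \<open>\<phi> x = \<parallel>x\<parallel>\<^sup>2 - 2 g x\<close>: if
  \<open>g x = Re (cinner x u)\<close>, then \<open>\<phi> x = \<parallel>x - u\<parallel>\<^sup>2 - \<parallel>u\<parallel>\<^sup>2\<close>. Boundedness of \<open>g\<close> bounds \<open>\<phi>\<close> from below, the
  parallelogram law makes minimising sequences Cauchy, and the vanishing of the
  first variation at the minimiser is the representation formula.\<close>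

lemma Riesz_representation_Re:
  fixes g :: "'a::complex_hilbert_space \<Rightarrow> real"
  assumes "bounded_linear g"
  obtains u where "\<And>x. g x = Re (cinner x u)"
proof -
  interpret g: bounded_linear g by fact
  define \<phi> where "\<phi> x = (norm x)\<^sup>2 - 2 * g x" for x
  define m where "m = Inf (range \<phi>)"
  obtain K where K: "\<And>x. norm (g x) \<le> norm x * K" using g.bounded by blast
  have "- K\<^sup>2 \<le> \<phi> x" for x
    using K[of x] zero_le_power2[of "norm x - K"] by (simp add: \<phi>_def power2_diff)
  then have bdd: "bdd_below (range \<phi>)" by (rule bdd_belowI2)
  have m_le: "m \<le> \<phi> x" for x unfolding m_def using bdd by (simp add: cInf_lower)
  have "\<exists>x. \<phi> x < m + inverse (real (Suc n))" for n
    using cInf_lessD[of "range \<phi>" "m + inverse (real (Suc n))"] by (auto simp: m_def)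
  then obtain X where X: "\<And>n. \<phi> (X n) < m + inverse (real (Suc n))" by metis
  have diff: "(norm (x - y))\<^sup>2 \<le> 2 * (\<phi> x - m) + 2 * (\<phi> y - m)" for x y
  proof -
    have "m \<le> (norm (x + y))\<^sup>2 / 4 - g x - g y"
      using m_le[of "(1/2) *\<^sub>R (x + y)"]
      by (simp add: \<phi>_def g.scaleR g.add power_divide add_divide_distrib)
    then show ?thesis using parallelogram_law[of x y] unfolding \<phi>_def by argo
  qed
  have "Cauchy X"
  proof (rule metric_CauchyI)
    fix e :: real assume "0 < e"
    then obtain N where N: "inverse (real (Suc N)) < e\<^sup>2 / 4"
      using reals_Archimedean[of "e\<^sup>2 / 4"] by auto
    have near: "\<phi> (X n) - m < e\<^sup>2 / 4" if "n \<ge> N" for n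
    proof -
      have "inverse (real (Suc n)) \<le> inverse (real (Suc N))" using that by (simp add: le_imp_inverse_le)
      then show ?thesis using X[of n] N by linarith
    qed
    have "dist (X k) (X n) < e" if "k \<ge> N" "n \<ge> N" for k n
    proof -
      have "(norm (X k - X n))\<^sup>2 < e\<^sup>2"
        using diff[of "X k" "X n"] near[OF that(1)] near[OF that(2)] by argo
      then show ?thesis using \<open>0 < e\<close> by (simp add: dist_norm power_less_imp_less_base)
    qed
    then show "\<exists>N. \<forall>k\<ge>N. \<forall>n\<ge>N. dist (X k) (X n) < e" by blast
  qed
  then obtain u where u: "X \<longlonglongrightarrow> u" using Cauchy_convergent convergent_def by blast
  have "(\<lambda>n. \<phi> (X n)) \<longlonglongrightarrow> \<phi> u"
    unfolding \<phi>_def by (intro tendsto_intros u g.tendsto)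
  moreover have "(\<lambda>n. m + inverse (real (Suc n))) \<longlonglongrightarrow> m"
    using tendsto_add[OF tendsto_const[of m] LIMSEQ_inverse_real_of_nat] by simp
  ultimately have "\<phi> u \<le> m"
    by (rule LIMSEQ_le) (use X less_imp_le in blast)
  then have min: "\<phi> u \<le> \<phi> x" for x using m_le[of x] by linarith
  have "g x = Re (cinner x u)" for x
  proof (cases "x = 0")
    case True
    then show ?thesis using Re_cinner_scaleR_left[of 0 x u] by simp
  next
    case False
    define d where "d = Re (cinner x u) - g x"
    have expand: "\<phi> (t *\<^sub>R x + u) = \<phi> u + 2 * t * d + t\<^sup>2 * (norm x)\<^sup>2" for t
      unfolding \<phi>_def d_def norm_add_square Re_cinner_scaleR_left g.add g.scaleR
      by (simp add: power_mult_distrib algebra_simps)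
    \<comment> \<open>The quadratic in \<open>t\<close> is smallest at \<open>t = - d / \<parallel>x\<parallel>\<^sup>2\<close>, where it drops by \<open>d\<^sup>2 / \<parallel>x\<parallel>\<^sup>2\<close>.\<close>
    have "0 \<le> 2 * (- d / (norm x)\<^sup>2) * d + (- d / (norm x)\<^sup>2)\<^sup>2 * (norm x)\<^sup>2"
      using min[of "(- d / (norm x)\<^sup>2) *\<^sub>R x + u"] unfolding expand by linarith
    also have "\<dots> = - (d\<^sup>2 / (norm x)\<^sup>2)"
      using False by (simp add: field_simps power2_eq_square)
    finally have "d\<^sup>2 / (norm x)\<^sup>2 \<le> 0" by simp
    then show ?thesis using False by (simp add: d_def divide_le_0_iff)
  qed
  then show thesis by (rule that)
qed

lemma cadjoint_eqI:
  assumes "\<And>x y. cinner (A x) y = cinner x (B y)"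
  shows "cadjoint A = B"
  unfolding cadjoint_def
proof (rule the_equality)
  fix B' assume "\<forall>x y. cinner (A x) y = cinner x (B' y)"
  then have "cinner x (B' y) = cinner x (B y)" for x y by (metis assms)
  then have "B' y = B y" for y by (rule cinner_right_eqI)
  then show "B' = B" by (rule ext)
qed (use assms in auto)

text \<open>Riesz representation of the real functionals \<open>x \<mapsto> Re (cinner (A x) y)\<close> provides the adjoint up to
  real parts; complex linearity of \<open>A\<close> then recovers the imaginary parts.\<close>

lemma cinner_cadjoint:
  assumes A: "bounded_clinear A"
  shows "cinner (A x) y = cinner x (cadjoint A y)"
proof -
  have "\<exists>u. \<forall>x. Re (cinner (A x) y) = Re (cinner x u)" for y
    using A by (auto simp: bounded_clinear_def
        intro: Riesz_representation_Re[OF bounded_linear_Re_cinner])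
  then obtain B where B: "\<And>x y. Re (cinner (A x) y) = Re (cinner x (B y))" by metis
  have "cinner (A x) y = cinner x (B y)" for x y
  proof (rule complex_eqI)
    have "\<i> *\<^sub>C A x = A (\<i> *\<^sub>C x)" using A by (simp add: bounded_clinear_def)
    then show "Im (cinner (A x) y) = Im (cinner x (B y))" by (simp only: Im_cinner_eq_Re B)
  qed (rule B)
  moreover from this have "cadjoint A = B" by (rule cadjoint_eqI)
  ultimately show ?thesis by simp
qed

lemma conjugation_involution: "conjugation C \<Longrightarrow> C (C x) = x"
  by (metis conjugation_def comp_apply id_apply)

text \<open>The antilinear form of self-adjointness: moving \<open>C\<close> across also swaps the two arguments.\<close>

lemma cinner_conjugation_left: "conjugation C \<Longrightarrow> cinner (C x) y = cinner (C y) x"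
  by (metis conjugation_def conjugation_involution)

lemma norm_conjugation: "conjugation C \<Longrightarrow> norm (C x) = norm x"
  by (simp add: conjugation_def norm_eq_sqrt_cinner)

lemma bounded_clinear_conjugations_comp:
  assumes C: "conjugation C" and J: "conjugation J" and A: "bounded_clinear A"
  shows "bounded_clinear (C \<circ> J \<circ> A)"
proof -
  interpret A: bounded_linear A using A by (simp add: bounded_clinear_def)
  have scaleC: "(C \<circ> J \<circ> A) (a *\<^sub>C x) = a *\<^sub>C (C \<circ> J \<circ> A) x" for a x
    using assms by (simp add: conjugation_def antilinear_def bounded_clinear_def)
  obtain K where K: "\<And>x. norm (A x) \<le> norm x * K" using A.bounded by blast
  have "bounded_linear (C \<circ> J \<circ> A)"
  proof (rule bounded_linear_intro[where K = K])
    show "(C \<circ> J \<circ> A) (r *\<^sub>R x) = r *\<^sub>R (C \<circ> J \<circ> A) x" for r x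
      by (simp only: scaleR_scaleC scaleC)
    show "(C \<circ> J \<circ> A) (x + y) = (C \<circ> J \<circ> A) x + (C \<circ> J \<circ> A) y" for x y
      using C J by (simp add: conjugation_def antilinear_def A.add)
    show "norm ((C \<circ> J \<circ> A) x) \<le> norm x * K" for x
      by (simp add: norm_conjugation[OF C] norm_conjugation[OF J] K)
  qed
  with scaleC show ?thesis by (simp add: bounded_clinear_def)
qed

lemma cadjoint_conjugations_comp:
  assumes C: "conjugation C" and J: "conjugation J" and A: "bounded_clinear A"
  shows "cadjoint (C \<circ> J \<circ> A) = cadjoint A \<circ> J \<circ> C"
proof (rule cadjoint_eqI)
  fix x y
  have "cinner ((C \<circ> J \<circ> A) x) y = cinner (C y) (J (A x))"
    using cinner_conjugation_left[OF C] by simp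
  also have "\<dots> = cinner (A x) (J (C y))"
    by (metis cinner_commute cinner_conjugation_left[OF J])
  finally show "cinner ((C \<circ> J \<circ> A) x) y = cinner x ((cadjoint A \<circ> J \<circ> C) y)"
    by (simp add: cinner_cadjoint[OF A])
qed

theorem proposition4p6:
  fixes C J T :: "'a::complex_hilbert_space \<Rightarrow> 'a"
  assumes "separable_space (euclidean :: 'a topology)"
    and "conjugation C" and "conjugation J"
    and "bounded_clinear T"
    and "T = C \<circ> J \<circ> abs_op T"
    and "C \<circ> abs_op T = cadjoint (abs_op T) \<circ> C"
    and "C \<circ> J = J \<circ> C"
  shows "J_symmetric J T"
proof -
  define P where "P = abs_op T"
  note C = \<open>conjugation C\<close> and J = \<open>conjugation J\<close>
  have CC: "C (C x) = x" and JJ: "J (J x) = x" for x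
    using conjugation_involution C J by auto
  have CJ: "C (J x) = J (C x)" for x
    using \<open>C \<circ> J = J \<circ> C\<close> by (metis comp_apply)
  have T: "T = C \<circ> J \<circ> P" using assms(5) unfolding P_def .
  have CP: "C (P x) = cadjoint P (C x)" for x
    using assms(6) unfolding P_def by (metis comp_apply)
  have "T x = C (J (P x))" for x using fun_cong[OF T, of x] by simp
  then have "P = C \<circ> J \<circ> T" by (simp add: fun_eq_iff CJ CC JJ)
  then have "bounded_clinear P"
    using bounded_clinear_conjugations_comp[OF C J \<open>bounded_clinear T\<close>] by simp
  then have adj: "cadjoint T = cadjoint P \<circ> J \<circ> C"
    unfolding T by (rule cadjoint_conjugations_comp[OF C J])
  have "J (T x) = cadjoint T (J x)" for x
  proof -
    have "J (T x) = C (P x)" using \<open>\<And>x. T x = C (J (P x))\<close> by (simp add: CJ JJ)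
    also have "\<dots> = cadjoint T (J x)" by (simp add: adj CP CJ JJ)
    finally show ?thesis .
  qed
  then show ?thesis by (simp add: J_symmetric_def fun_eq_iff)
qed

end
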